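(* Let $T:\mathbb{Z}_2\to\mathbb{Z}_2$ be the Collatz map on the $2$-adic integers, $T(f)=f/2$ if $f\equiv 0 \pmod 2$ and $T(f)=3f+1$ otherwise. For every $n\ge 1$, the number $Z_n$ of $T$-cycles of length $n$ in $\mathbb{Z}_2$ is finite and equals $$Z_n=\frac1n\sum_{d\mid n}\mu(d)\left(\phi^{n/d}+\psi^{n/d}\right),\qquad \phi=\frac{1+\sqrt5}{2},\ \psi=\frac{1-\sqrt5}{2}.$$ Moreover $Z_n\sim \frac{\phi^n}{n}$ as $n\to\infty$.
   Context: An element $f\in\mathbb{Z}_2$ is $T$-periodic if $T^k(f)=f$ for some $k\ge1$; the minimal such $k$ is its period, and its orbit is a $T$-cycle of length equal to the period. $\mu$ is the Möbius function. *)

theory Defs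
  imports
    Complex_Main
    "HOL-Computational_Algebra.Squarefree"
    "HOL-Combinatorics.Orbits"
    "HOL-Library.Landau_Symbols"
begin

text \<open>The 2-adic integers as the inverse limit of the rings of integers modulo \<open>2 ^ n\<close>: the
  component at \<open>n\<close> is the canonical representative of the residue class modulo \<open>2 ^ n\<close>.\<close>

typedef zadic2 =
  "{a :: nat \<Rightarrow> int. \<forall>n. 0 \<le> a n \<and> a n < 2 ^ n \<and> a (Suc n) mod 2 ^ n = a n}"
  by (rule exI[of _ "\<lambda>_. 0"]) auto

setup_lifting type_definition_zadic2

lemma coherent_mod_power:
  fixes f :: "nat \<Rightarrow> int"
  assumes "\<And>n. f (Suc n) mod 2 ^ n = f n mod 2 ^ n"
  shows "0 \<le> f n mod 2 ^ n \<and> f n mod 2 ^ n < 2 ^ n \<and> (f (Suc n) mod 2 ^ Suc n) mod 2 ^ n = f n mod 2 ^ n"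
proof -
  have "(x mod 2 ^ Suc n) mod 2 ^ n = x mod 2 ^ n" for x :: int and n
    by (rule mod_mod_cancel) (simp add: le_imp_power_dvd)
  then show ?thesis
    using assms by (simp del: power_Suc)
qed

instantiation zadic2 :: comm_ring_1
begin

lift_definition zero_zadic2 :: zadic2 is "\<lambda>_. 0"
  by simp

lift_definition one_zadic2 :: zadic2 is "\<lambda>n. 1 mod 2 ^ n"
  by (rule coherent_mod_power) (rule refl)

lift_definition plus_zadic2 :: "zadic2 \<Rightarrow> zadic2 \<Rightarrow> zadic2" is "\<lambda>a b n. (a n + b n) mod 2 ^ n"
  by (rule coherent_mod_power, rule mod_add_cong) auto

lift_definition minus_zadic2 :: "zadic2 \<Rightarrow> zadic2 \<Rightarrow> zadic2" is "\<lambda>a b n. (a n - b n) mod 2 ^ n"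
  by (rule coherent_mod_power, rule mod_diff_cong) auto

lift_definition times_zadic2 :: "zadic2 \<Rightarrow> zadic2 \<Rightarrow> zadic2" is "\<lambda>a b n. (a n * b n) mod 2 ^ n"
  by (rule coherent_mod_power, rule mod_mult_cong) auto

lift_definition uminus_zadic2 :: "zadic2 \<Rightarrow> zadic2" is "\<lambda>a n. (- a n) mod 2 ^ n"
  by (rule coherent_mod_power, rule mod_minus_cong) auto

instance
proof
  fix a b c :: zadic2
  show "a * b * c = a * (b * c)"
    by transfer (simp only: mod_mult_left_eq mod_mult_right_eq mult.assoc)
  show "a * b = b * a"
    by transfer (simp only: mult.commute)
  show "1 * a = a"
    by transfer (simp only: mod_mult_left_eq mult_1_left mod_pos_pos_trivial)
  show "a + b + c = a + (b + c)"
    by transfer (simp only: mod_add_left_eq mod_add_right_eq add.assoc)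
  show "a + b = b + a"
    by transfer (simp only: add.commute)
  show "0 + a = a"
    by transfer (simp add: fun_eq_iff)
  show "- a + a = 0"
    by transfer (simp add: mod_add_left_eq)
  show "a - b = a + - b"
    by transfer (simp add: mod_add_right_eq)
  show "(a + b) * c = a * c + b * c"
    by transfer (simp only: mod_mult_left_eq mod_add_left_eq mod_add_right_eq distrib_right)
  show "(0::zadic2) \<noteq> 1"
  proof transfer
    show "(\<lambda>_. 0) \<noteq> (\<lambda>n. 1 mod 2 ^ n :: int)"
      by (auto dest!: fun_cong[of _ _ 1])
  qed
qed

end

lemma zadic2_double_cancel:
  fixes f g :: zadic2
  assumes "2 * f = 2 * g"
  shows "f = g"
proof -
  have "f + f = g + g"
    using assms by (simp only: mult_2)
  then show ?thesis
  proof transfer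
    fix a b :: "nat \<Rightarrow> int"
    assume a: "\<forall>n. 0 \<le> a n \<and> a n < 2 ^ n \<and> a (Suc n) mod 2 ^ n = a n"
      and b: "\<forall>n. 0 \<le> b n \<and> b n < 2 ^ n \<and> b (Suc n) mod 2 ^ n = b n"
      and eq: "(\<lambda>n. (a n + a n) mod 2 ^ n) = (\<lambda>n. (b n + b n) mod 2 ^ n)"
    show "a = b"
    proof
      fix n
      have "(2 * a (Suc n)) mod (2 * 2 ^ n) = (2 * b (Suc n)) mod (2 * 2 ^ n)"
        using fun_cong[OF eq, of "Suc n"] by (simp only: power_Suc mult_2[of "_ (Suc n)"])
      then have "a (Suc n) mod 2 ^ n = b (Suc n) mod 2 ^ n"
        by (simp only: mod_mult_mult1 mult_left_cancel[OF zero_neq_numeral[symmetric]])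
      then show "a n = b n"
        using a b by metis
    qed
  qed
qed

definition zadic2_half :: "zadic2 \<Rightarrow> zadic2" where
  "zadic2_half f = (THE g. f = 2 * g)"

lemma zadic2_half_double [simp]: "zadic2_half (2 * g) = g"
  unfolding zadic2_half_def by (rule the_equality) (auto dest: zadic2_double_cancel)

definition collatz :: "zadic2 \<Rightarrow> zadic2" where
  "collatz f = (if 2 dvd f then zadic2_half f else 3 * f + 1)"

definition is_periodic :: "('a \<Rightarrow> 'a) \<Rightarrow> 'a \<Rightarrow> bool" where
  "is_periodic T f \<longleftrightarrow> (\<exists>k\<ge>1. (T ^^ k) f = f)"

definition period :: "('a \<Rightarrow> 'a) \<Rightarrow> 'a \<Rightarrow> nat" where
  "period T f = (LEAST k. k \<ge> 1 \<and> (T ^^ k) f = f)"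

text \<open>The library's \<^const>\<open>orbit\<close> consists of the iterates with positive exponent; for a periodic
  element this is the whole forward orbit, including the element itself.\<close>

definition cycles :: "('a \<Rightarrow> 'a) \<Rightarrow> nat \<Rightarrow> 'a set set" where
  "cycles T n = {orbit T f | f. is_periodic T f \<and> period T f = n}"

definition moebius_mu :: "nat \<Rightarrow> int" where
  "moebius_mu n = (if squarefree n then (- 1) ^ card (prime_factors n) else 0)"

end

theory Submission
  imports Defs "HOL-Combinatorics.Cycles" "HOL-Number_Theory.Cong"
begin

text \<open>A point fixed by the \<open>n\<close>-th iterate is determined by the parities of its first \<open>n\<close>
  iterates: along a given parity word the inverse branches compose to an affine map whose slope is
  even, and such a map has exactly one fixed point because \<open>1 - A\<close> is a unit for even \<open>A\<close>. An odd
  number is mapped to an even one, and this is the only restriction, so the words that occur are the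
  cyclic binary words without two adjacent ones, counted by the Lucas number \<open>\<phi> ^ n + \<psi> ^ n\<close>.
  Sorting the fixed points by their period and Moebius inversion give the number of cycles, and the
  term of the trivial divisor dominates it.\<close>

section \<open>Moebius inversion\<close>

lemma squarefree_prod_prime_factors:
  fixes n :: nat
  assumes "squarefree n"
  shows "\<Prod>(prime_factors n) = n"
proof -
  have "n \<noteq> 0"
    using assms by (auto intro: ccontr)
  then have "n = (\<Prod>p\<in>prime_factors n. p ^ multiplicity p n)"
    by (intro prime_factorization_nat) auto
  also have "\<dots> = \<Prod>(prime_factors n)"
    using assms \<open>n \<noteq> 0\<close> by (intro prod.cong) (simp_all add: squarefree_factorial_semiring')
  finally show ?thesis ..
qed

text \<open>Only squarefree divisors contribute, and taking products identifies them with the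
  subsets of the prime factors of \<open>n\<close>. The signed count of these subsets is the
  expansion of a product of factors \<open>1 - 1\<close>, which is empty exactly for
  \<open>n = 1\<close>.\<close>

lemma sum_moebius_mu:
  assumes "n \<ge> 1"
  shows "(\<Sum>d | d dvd n. moebius_mu d) = (if n = 1 then 1 else 0)"
proof -
  have primes: "prime p" if "p \<in> prime_factors n" for p
    using that by auto
  have pf: "prime_factors (\<Prod>S) = S" if "S \<subseteq> prime_factors n" for S
  proof -
    have "finite S"
      using that finite_subset by blast
    then have "prime_factors (\<Prod>S) = (\<Union>p\<in>S. prime_factors p)"
      using primes that by (subst prime_factors_prod) (auto dest: prime_gt_0_nat)
    also have "\<dots> = (\<Union>p\<in>S. {p})"
      using primes that by (intro SUP_cong) (auto simp: prime_factorization_prime subset_iff)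
    also have "\<dots> = S"
      by simp
    finally show ?thesis .
  qed
  have sqf: "squarefree (\<Prod>S)" if "S \<subseteq> prime_factors n" for S
    using primes that by (intro squarefree_prod_coprime) (auto intro: primes_coprime squarefree_prime)
  have dvd: "\<Prod>S dvd n" if "S \<subseteq> prime_factors n" for S
  proof -
    have "\<Prod>S dvd \<Prod>(prime_factors n)"
      using that by (intro prod_dvd_prod_subset) auto
    also have "\<dots> dvd (\<Prod>p\<in>prime_factors n. p ^ multiplicity p n)"
    proof (rule prod_dvd_prod)
      fix p assume "p \<in> prime_factors n"
      then show "p dvd p ^ multiplicity p n"
        by (intro dvd_power) (simp add: prime_factors_multiplicity)
    qed
    also have "\<dots> = n"
      using assms by (intro prime_factorization_nat [symmetric]) auto
    finally show ?thesis .
  qed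
  have "(\<Sum>d | d dvd n. moebius_mu d) = (\<Sum>d | d dvd n \<and> squarefree d. (- 1) ^ card (prime_factors d))"
    using assms by (intro sum.mono_neutral_cong_right) (auto simp: moebius_mu_def)
  also have "\<dots> = (\<Sum>S\<in>Pow (prime_factors n). (- 1) ^ card S)"
    using assms
    by (intro sum.reindex_bij_witness[of _ "\<lambda>S. \<Prod>S" prime_factors])
       (auto simp: squarefree_prod_prime_factors pf sqf dvd dvd_prime_factors)
  also have "\<dots> = (\<Prod>p\<in>prime_factors n. 1 - 1)"
    by (subst prod_diff_conv_sum) simp_all
  also have "\<dots> = (if n = 1 then 1 else 0)"
    using assms by (auto simp: prime_factorization_empty_iff power_0_left)
  finally show ?thesis .
qed

text \<open>Inserting the divisor sum for \<open>f (n div d)\<close> and exchanging the sums leaves,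
  as coefficient of \<open>g e\<close>, the sum of \<open>moebius_mu\<close> over the divisors of
  \<open>n div e\<close>, which vanishes unless \<open>e = n\<close>.\<close>

lemma moebius_inversion:
  fixes f g :: "nat \<Rightarrow> 'a :: comm_ring_1"
  assumes f: "\<And>m. m \<ge> 1 \<Longrightarrow> f m = (\<Sum>d | d dvd m. g d)" and n: "n \<ge> 1"
  shows "g n = (\<Sum>d | d dvd n. of_int (moebius_mu d) * f (n div d))"
proof -
  let ?D = "{d. d dvd n}"
  have fin: "finite ?D"
    using n by simp
  \<comment> \<open>The condition \<open>d * e dvd n\<close> is symmetric in \<open>d\<close> and
    \<open>e\<close>, which is what permits the exchange of the sums.\<close>
  have quotient: "{e. e dvd n div d} = {e \<in> ?D. d * e dvd n}" if "d dvd n" for d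
  proof -
    have "d \<noteq> 0"
      using that n by auto
    then have "e dvd n div d \<longleftrightarrow> d * e dvd n" for e
      using that by (simp add: dvd_div_iff_mult mult.commute)
    then show ?thesis
      using dvd_mult_right by auto
  qed
  have "(\<Sum>d\<in>?D. of_int (moebius_mu d) * f (n div d))
      = (\<Sum>d\<in>?D. \<Sum>e | e \<in> ?D \<and> d * e dvd n. of_int (moebius_mu d) * g e)"
  proof (rule sum.cong)
    fix d assume "d \<in> ?D"
    moreover from this n have "n div d \<ge> 1"
      by (auto simp: Suc_le_eq div_greater_zero_iff intro: dvd_imp_le dvd_pos_nat)
    ultimately show "of_int (moebius_mu d) * f (n div d)
        = (\<Sum>e | e \<in> ?D \<and> d * e dvd n. of_int (moebius_mu d) * g e)"
      using quotient[of d] by (simp add: f sum_distrib_left)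
  qed simp
  also have "\<dots> = (\<Sum>e\<in>?D. \<Sum>d | d \<in> ?D \<and> d * e dvd n. of_int (moebius_mu d) * g e)"
    using fin by (rule sum.swap_restrict) (fact fin)
  also have "\<dots> = (\<Sum>e\<in>?D. if e = n then g e else 0)"
  proof (rule sum.cong)
    fix e assume e: "e \<in> ?D"
    then have "n div e \<ge> 1" "n div e = 1 \<longleftrightarrow> e = n"
      using n by (auto elim!: dvdE simp: Suc_le_eq)
    then have "(\<Sum>d | d dvd n div e. moebius_mu d) = (if e = n then 1 else 0)"
      using sum_moebius_mu[of "n div e"] by (simp only:)
    moreover have "{d \<in> ?D. d * e dvd n} = {d. d dvd n div e}"
      using quotient[of e] e by (simp add: mult.commute)
    ultimately show "(\<Sum>d | d \<in> ?D \<and> d * e dvd n. of_int (moebius_mu d) * g e) = (if e = n then g e else 0)"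
      by (simp only: sum_distrib_right[symmetric] of_int_sum[symmetric]) simp
  qed simp
  also have "\<dots> = g n"
    using fin by simp
  finally show ?thesis ..
qed

section \<open>Cycles and fixed points of iterates\<close>

lemma period_eq_least_power: "period T f = least_power T f"
  by (simp add: period_def least_power_def conj_commute Suc_le_eq)

lemma is_periodic_iff_self_in_orbit: "is_periodic T f \<longleftrightarrow> f \<in> orbit T f"
  unfolding is_periodic_def orbit_altdef mem_Collect_eq by (metis Suc_le_eq One_nat_def)

lemma funpow_period:
  assumes "is_periodic T f"
  shows "(T ^^ period T f) f = f" and "period T f > 0"
proof -
  obtain k where "(T ^^ k) f = f" "k > 0"
    using assms by (auto simp: is_periodic_def)
  then show "(T ^^ period T f) f = f" and "period T f > 0"
    unfolding period_eq_least_power by (rule least_powerI)+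
qed

lemma funpow_fixed_iff_period_dvd:
  assumes "n \<ge> 1"
  shows "(T ^^ n) f = f \<longleftrightarrow> is_periodic T f \<and> period T f dvd n"
proof
  assume "(T ^^ n) f = f"
  then show "is_periodic T f \<and> period T f dvd n"
    using assms by (auto simp: is_periodic_def period_eq_least_power least_power_minimal)
next
  assume "is_periodic T f \<and> period T f dvd n"
  then have "n mod period T f = 0" and "(T ^^ period T f) f = f"
    using funpow_period(1) by auto
  then show "(T ^^ n) f = f"
    using funpow_mod_eq[of "period T f" T f n] by simp
qed

lemma card_orbit_eq_period:
  assumes "is_periodic T f"
  shows "card (orbit T f) = period T f"
proof -
  let ?p = "period T f"
  have p: "(T ^^ ?p) f = f" "?p > 0"
    using funpow_period[OF assms] by auto
  have distinct: "(T ^^ i) f \<noteq> (T ^^ j) f" if "i < j" "j < ?p" for i j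
  proof
    assume "(T ^^ i) f = (T ^^ j) f"
    \<comment> \<open>Pushing the coincidence forward to the end of the period makes
      \<open>f\<close> recur after \<open>?p - j + i < ?p\<close> steps, against minimality.\<close>
    then have "(T ^^ (?p - j)) ((T ^^ i) f) = (T ^^ (?p - j)) ((T ^^ j) f)"
      by simp
    then have "(T ^^ (?p - j + i)) f = f"
      using that p by (simp flip: funpow_add[THEN fun_cong, unfolded o_apply])
    then have "?p \<le> ?p - j + i"
      using that unfolding period_eq_least_power by (intro least_power_le) auto
    then show False
      using that by simp
  qed
  have "inj_on (\<lambda>i. (T ^^ i) f) {..<?p}"
    by (rule linorder_inj_onI) (use distinct in auto)
  moreover have "orbit T f = (\<lambda>i. (T ^^ i) f) ` {..<?p}"
    using orbit_altdef_bounded[OF p] by auto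
  ultimately show ?thesis
    by (simp add: card_image)
qed

text \<open>\<open>T\<close> need not be injective, so the way back from \<open>g\<close> to
  \<open>f\<close> comes from the periodicity of \<open>f\<close>. The periods agree because both
  count the common orbit.\<close>

lemma orbit_periodic_eq:
  assumes "is_periodic T f" and "g \<in> orbit T f"
  shows "orbit T g = orbit T f" and "is_periodic T g" and "period T g = period T f"
proof -
  show "orbit T g = orbit T f"
  proof
    show "orbit T g \<subseteq> orbit T f"
      using orbit_trans[OF _ assms(2)] by (rule subsetI)
    have "f \<in> orbit T g"
      using assms orbit_swap[of f T g] by (simp only: is_periodic_iff_self_in_orbit)
    then show "orbit T f \<subseteq> orbit T g"
      using orbit_trans[of _ T f g] by (intro subsetI)
  qed
  moreover show "is_periodic T g"
    using assms self_in_orbit_trans[of f T g] by (simp add: is_periodic_iff_self_in_orbit)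
  ultimately show "period T g = period T f"
    using assms(1) card_orbit_eq_period[of T f] card_orbit_eq_period[of T g] by simp
qed

lemma cycles_eq_image: "cycles T n = orbit T ` {f. is_periodic T f \<and> period T f = n}"
  by (auto simp: cycles_def)

text \<open>The fibre of \<open>orbit T\<close> over a cycle is the cycle itself, so the cycles
  partition the points of period \<open>n\<close> into blocks of size \<open>n\<close>.\<close>

lemma card_period_eq:
  assumes "finite {f. is_periodic T f \<and> period T f = n}"
  shows "card {f. is_periodic T f \<and> period T f = n} = n * card (cycles T n)"
proof -
  let ?P = "{f. is_periodic T f \<and> period T f = n}"
  have "card ?P = (\<Sum>C\<in>orbit T ` ?P. card {f \<in> ?P. orbit T f = C})"
    using sum.image_gen[OF assms, of "\<lambda>_. 1::nat" "orbit T"] by simp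
  also have "\<dots> = (\<Sum>C\<in>orbit T ` ?P. n)"
  proof (rule sum.cong)
    fix C assume "C \<in> orbit T ` ?P"
    then obtain f where f: "is_periodic T f" "period T f = n" "C = orbit T f"
      by auto
    have "g \<in> ?P \<and> orbit T g = C" if "g \<in> C" for g
      using orbit_periodic_eq[of T f g] f that by simp
    moreover have "g \<in> C" if "g \<in> ?P" "orbit T g = C" for g
      using that is_periodic_iff_self_in_orbit[of T g] by simp
    ultimately have "{g \<in> ?P. orbit T g = C} = C"
      by blast
    then show "card {g \<in> ?P. orbit T g = C} = n"
      using f card_orbit_eq_period[of T f] by simp
  qed simp
  finally show ?thesis
    by (simp add: cycles_eq_image mult.commute)
qed

lemma card_funpow_fixed_eq_sum_cycles:
  assumes "n \<ge> 1" and "finite {f. (T ^^ n) f = f}"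
  shows "card {f. (T ^^ n) f = f} = (\<Sum>d | d dvd n. d * card (cycles T d))"
proof -
  let ?P = "\<lambda>d. {f. is_periodic T f \<and> period T f = d}"
  have eq: "{f. (T ^^ n) f = f} = (\<Union>d\<in>{d. d dvd n}. ?P d)"
    using assms(1) by (auto simp: funpow_fixed_iff_period_dvd)
  have fin: "finite (?P d)" if "d dvd n" for d
    by (rule finite_subset[OF _ assms(2)]) (use that eq in auto)
  have "card {f. (T ^^ n) f = f} = (\<Sum>d | d dvd n. card (?P d))"
    unfolding eq using assms(1) fin by (intro card_UN_disjoint) auto
  also have "\<dots> = (\<Sum>d | d dvd n. d * card (cycles T d))"
    using fin by (intro sum.cong) (auto simp: card_period_eq)
  finally show ?thesis .
qed

lemma finite_cycles:
  assumes "n \<ge> 1" and "finite {f. (T ^^ n) f = f}"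
  shows "finite (cycles T n)"
  unfolding cycles_eq_image
  by (rule finite_imageI, rule finite_subset[OF _ assms(2)])
     (use assms(1) in \<open>auto simp: funpow_fixed_iff_period_dvd\<close>)

section \<open>Parity and units of the 2-adic integers\<close>

lemma zadic2_two_not_dvd_one: "\<not> 2 dvd (1 :: zadic2)"
proof
  assume "2 dvd (1 :: zadic2)"
  then obtain g :: zadic2 where "1 = g + g"
    unfolding mult_2[symmetric] by (rule dvdE)
  then show False
  proof transfer
    fix a :: "nat \<Rightarrow> int"
    assume "(\<lambda>n. 1 mod 2 ^ n) = (\<lambda>n. (a n + a n) mod 2 ^ n)"
    \<comment> \<open>The component at 1 is the residue modulo 2, where the two sides are 1 and
      0.\<close>
    from fun_cong[OF this, of 1] show False
      by simp
  qed
qed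

lemma zadic2_dvd_diff_one:
  fixes f :: zadic2
  assumes "\<not> 2 dvd f"
  shows "2 dvd f - 1"
proof -
  have "\<exists>g. f = g + g \<or> f = g + g + 1"
  proof transfer
    fix a :: "nat \<Rightarrow> int"
    assume a: "\<forall>n. 0 \<le> a n \<and> a n < 2 ^ n \<and> a (Suc n) mod 2 ^ n = a n"
    \<comment> \<open>Halving costs one binary digit, hence the shift of the index. The component at
      0 is always 0, so the parity is read off at index 1.\<close>
    let ?g = "\<lambda>n. a (Suc n) div 2"
    have parity: "a (Suc n) mod 2 = a 1 mod 2" for n
    proof (induction n)
      case (Suc n)
      have "a (Suc (Suc n)) mod 2 = (a (Suc (Suc n)) mod 2 ^ Suc n) mod 2"
        by (subst mod_mod_cancel) auto
      also have "\<dots> = a (Suc n) mod 2"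
        using a by metis
      finally show ?case
        using Suc by simp
    qed simp
    have half: "a (Suc n) = ?g n + ?g n + a 1 mod 2" for n
      using parity[of n] by presburger
    have g: "0 \<le> ?g n \<and> ?g n < 2 ^ n \<and> ?g (Suc n) mod 2 ^ n = ?g n" for n
    proof -
      have "0 \<le> a (Suc n)" "a (Suc n) < 2 * 2 ^ n" "a (Suc (Suc n)) mod (2 * 2 ^ n) = a (Suc n)"
        using a power_Suc by metis+
      moreover from this(3) have "a (Suc n) = 2 * (?g (Suc n) mod 2 ^ n) + a (Suc (Suc n)) mod 2"
        by (simp add: zmod_zmult2_eq)
      then have "?g n = ?g (Suc n) mod 2 ^ n"
        by linarith
      ultimately show ?thesis
        by auto
    qed
    have val: "a n = (((?g n + ?g n) mod 2 ^ n) + a 1 mod 2) mod 2 ^ n" for n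
      using half[of n] a by (metis mod_add_left_eq)
    have "a 1 mod 2 = 0 \<or> a 1 mod 2 = 1"
      by auto
    then show "\<exists>g\<in>{a. \<forall>n. 0 \<le> a n \<and> a n < 2 ^ n \<and> a (Suc n) mod 2 ^ n = a n}.
        a = (\<lambda>n. (g n + g n) mod 2 ^ n) \<or> a = (\<lambda>n. ((g n + g n) mod 2 ^ n + 1 mod 2 ^ n) mod 2 ^ n)"
    proof (intro bexI[of _ ?g], elim disj_forward)
      assume "a 1 mod 2 = 0"
      then show "a = (\<lambda>n. (?g n + ?g n) mod 2 ^ n)"
        using val by (intro ext) (metis add_0_right mod_mod_trivial)
    next
      assume "a 1 mod 2 = 1"
      then show "a = (\<lambda>n. ((?g n + ?g n) mod 2 ^ n + 1 mod 2 ^ n) mod 2 ^ n)"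
        using val by (intro ext) (metis mod_add_right_eq)
    qed (use g in auto)
  qed
  then obtain g where "f = 2 * g \<or> f = 2 * g + 1"
    unfolding mult_2 by (rule exE)
  then have "f = 2 * g + 1"
    using assms dvd_triv_left by metis
  then show ?thesis
    by simp
qed

text \<open>The inverse of \<open>1 - 2 * g\<close> is the geometric series in \<open>2 * g\<close>, truncated modulo \<open>2 ^ n\<close>.\<close>

lemma zadic2_one_minus_even_unit: "\<exists>h. (1 - (g + g)) * h = (1 :: zadic2)"
proof transfer
  fix a :: "nat \<Rightarrow> int"
  assume a: "\<forall>n. 0 \<le> a n \<and> a n < 2 ^ n \<and> a (Suc n) mod 2 ^ n = a n"
  let ?s = "\<lambda>n. \<Sum>k<n. (2 * a n) ^ k"
  have s: "?s (Suc n) mod 2 ^ n = ?s n mod 2 ^ n" for n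
  proof -
    have "[2 * a (Suc n) = 2 * a n] (mod 2 ^ n)"
      using a by (intro cong_mult) (auto simp: cong_def)
    \<comment> \<open>The additional last term of the longer sum is divisible by
      \<open>2 ^ n\<close>, so the truncated series are coherent.\<close>
    then have "[(\<Sum>k<n. (2 * a (Suc n)) ^ k) + (2 * a (Suc n)) ^ n = ?s n + 0] (mod 2 ^ n)"
      by (intro cong_add cong_sum cong_pow) (auto simp: cong_0_iff power_mult_distrib)
    then show ?thesis
      by (simp add: cong_def)
  qed
  have inv: "((1 mod 2 ^ n - (a n + a n) mod 2 ^ n) mod 2 ^ n * (?s n mod 2 ^ n)) mod 2 ^ n = 1 mod 2 ^ n" for n
  proof -
    have "((1 mod 2 ^ n - (a n + a n) mod 2 ^ n) mod 2 ^ n * (?s n mod 2 ^ n)) mod 2 ^ n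
        = ((1 - 2 * a n) * ?s n) mod 2 ^ n"
      by (simp only: mod_mult_left_eq mod_mult_right_eq mod_diff_left_eq mod_diff_right_eq mult_2)
    also have "(1 - 2 * a n) * ?s n = 1 - (2 * a n) ^ n"
      by (rule one_diff_power_eq[symmetric])
    also have "\<dots> mod 2 ^ n = 1 mod 2 ^ n"
      unfolding mod_eq_dvd_iff by (simp add: power_mult_distrib)
    finally show ?thesis .
  qed
  show "\<exists>h\<in>{a. \<forall>n. 0 \<le> a n \<and> a n < 2 ^ n \<and> a (Suc n) mod 2 ^ n = a n}.
      (\<lambda>n. ((1 mod 2 ^ n - (a n + a n) mod 2 ^ n) mod 2 ^ n * h n) mod 2 ^ n) = (\<lambda>n. 1 mod 2 ^ n)"
    using inv coherent_mod_power[of ?s, OF s]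
    by (intro bexI[of _ "\<lambda>n. ?s n mod 2 ^ n"]) auto
qed

lemma zadic2_even_unit:
  fixes f :: zadic2
  assumes "2 dvd f"
  shows "\<exists>h. (1 - f) * h = 1"
proof -
  obtain g where "f = g + g"
    using assms unfolding mult_2[symmetric] by (rule dvdE)
  then show ?thesis
    using zadic2_one_minus_even_unit by simp
qed

section \<open>Inverse branches and itineraries\<close>

definition zadic2_third :: zadic2 where
  "zadic2_third = (SOME t. 3 * t = 1)"

text \<open>3 is a unit, being \<open>1 - f\<close> for the even number
  \<open>f = - 2\<close>.\<close>

lemma zadic2_third: "3 * zadic2_third = 1"
proof -
  have "2 dvd (- 2 :: zadic2)"
    by simp
  from zadic2_even_unit[OF this] have "\<exists>t. 3 * t = (1 :: zadic2)"
    by simp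
  then show ?thesis
    unfolding zadic2_third_def by (rule someI_ex)
qed

text \<open>The odd branch yields a preimage of \<open>g\<close> under the Collatz map only for even \<open>g\<close>; this is the
  sole obstruction to prescribing parities.\<close>

definition collatz_branch :: "bool \<Rightarrow> zadic2 \<Rightarrow> zadic2" where
  "collatz_branch b g = (if b then zadic2_third * (g - 1) else 2 * g)"

lemma collatz_branch_collatz: "collatz_branch (\<not> 2 dvd f) (collatz f) = f"
proof (cases "2 dvd f")
  case True
  then obtain g where "f = 2 * g"
    by (rule dvdE)
  then show ?thesis
    by (simp add: collatz_branch_def collatz_def)
next
  case False
  have "zadic2_third * (3 * f) = 3 * zadic2_third * f"
    by (simp only: mult_ac)
  then show ?thesis
    using False zadic2_third by (simp add: collatz_branch_def collatz_def)
qed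

text \<open>Multiplication by 3 undoes \<open>zadic2_third\<close>, so an even value of the odd
  branch would make both \<open>g\<close> and \<open>g - 1\<close> even, and hence 1.\<close>

lemma odd_collatz_branch_iff:
  assumes "b \<Longrightarrow> 2 dvd g"
  shows "\<not> 2 dvd collatz_branch b g \<longleftrightarrow> b"
proof (cases b)
  case True
  have "\<not> 2 dvd zadic2_third * (g - 1)"
  proof
    assume "2 dvd zadic2_third * (g - 1)"
    then have "2 dvd 3 * (zadic2_third * (g - 1))"
      by (rule dvd_mult)
    then have "2 dvd g - 1"
      by (simp only: mult.assoc[symmetric] zadic2_third mult_1)
    with assms[OF True] have "2 dvd g - (g - 1)"
      by (rule dvd_diff)
    then show False
      using zadic2_two_not_dvd_one by simp
  qed
  then show ?thesis
    using True by (simp add: collatz_branch_def)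
qed (simp add: collatz_branch_def)

lemma collatz_collatz_branch:
  assumes "b \<Longrightarrow> 2 dvd g"
  shows "collatz (collatz_branch b g) = g"
proof (cases b)
  case True
  have "3 * (zadic2_third * (g - 1)) + 1 = g"
    by (simp only: mult.assoc[symmetric] zadic2_third mult_1) simp
  moreover have "\<not> 2 dvd collatz_branch b g"
    using odd_collatz_branch_iff[of b g] assms True by blast
  ultimately show ?thesis
    using True by (simp add: collatz_def collatz_branch_def)
qed (simp add: collatz_def collatz_branch_def)

lemma even_collatz:
  assumes "\<not> 2 dvd f"
  shows "2 dvd collatz f"
proof -
  \<comment> \<open>This splits \<open>3 * f + 1\<close> into three summands, each of them even for
    odd \<open>f\<close>.\<close>
  have "collatz f = 2 * f + (f - 1) + 2"
    using assms by (simp add: collatz_def)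
  also have "2 dvd \<dots>"
    using zadic2_dvd_diff_one[OF assms] by (intro dvd_add) auto
  finally show ?thesis .
qed

text \<open>The letter \<open>True\<close> stands for an odd iterate; an odd iterate is always
  followed by an even one.\<close>

abbreviation sparse :: "bool list \<Rightarrow> bool" where
  "sparse \<equiv> successively (\<lambda>a b. \<not> (a \<and> b))"

definition itinerary :: "nat \<Rightarrow> zadic2 \<Rightarrow> bool list" where
  "itinerary n f = map (\<lambda>i. \<not> 2 dvd (collatz ^^ i) f) [0..<n]"

lemma length_itinerary [simp]: "length (itinerary n f) = n"
  by (simp add: itinerary_def)

lemma itinerary_0 [simp]: "itinerary 0 f = []"
  by (simp add: itinerary_def)

lemma itinerary_Suc: "itinerary (Suc n) f = (\<not> 2 dvd f) # itinerary n (collatz f)"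
  by (simp add: itinerary_def map_upt_Suc funpow_swap1 del: upt_Suc)

lemma foldr_collatz_branch_itinerary:
  "foldr collatz_branch (itinerary n f) ((collatz ^^ n) f) = f"
  by (induction n arbitrary: f)
     (simp_all add: itinerary_Suc funpow_swap1 collatz_branch_collatz)

text \<open>The parity after \<open>n\<close> steps is appended so that the last step is checked
  too. The statement about \<open>hd\<close> serves the induction: it names the letter next to a
  newly prepended one.\<close>

lemma sparse_itinerary:
  "hd (itinerary n f @ [\<not> 2 dvd (collatz ^^ n) f]) = (\<not> 2 dvd f) \<and>
   sparse (itinerary n f @ [\<not> 2 dvd (collatz ^^ n) f])"
proof (induction n arbitrary: f)
  case (Suc n)
  show ?case
    using Suc[of "collatz f"] even_collatz[of f]
    by (auto simp: itinerary_Suc successively_Cons funpow_swap1)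
qed simp

text \<open>Sparseness guarantees that the odd branch is only ever applied to even numbers, where
  \<open>collatz\<close> inverts it. The parity of the value is carried along to know this in the
  induction.\<close>

lemma itinerary_foldr_collatz_branch:
  assumes "sparse (xs @ [\<not> 2 dvd g])"
  shows "(\<not> 2 dvd foldr collatz_branch xs g) = hd (xs @ [\<not> 2 dvd g])"
    and "(collatz ^^ length xs) (foldr collatz_branch xs g) = g"
    and "itinerary (length xs) (foldr collatz_branch xs g) = xs"
proof -
  have "(\<not> 2 dvd foldr collatz_branch xs g) = hd (xs @ [\<not> 2 dvd g]) \<and>
    (collatz ^^ length xs) (foldr collatz_branch xs g) = g \<and>
    itinerary (length xs) (foldr collatz_branch xs g) = xs"
    using assms
  proof (induction xs)
    case (Cons x xs)
    let ?h = "foldr collatz_branch xs g"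
    have sparse: "\<not> (x \<and> hd (xs @ [\<not> 2 dvd g]))" "sparse (xs @ [\<not> 2 dvd g])"
      using Cons.prems by (simp_all add: successively_Cons)
    note IH = Cons.IH[OF sparse(2)]
    have even: "2 dvd ?h" if x
      using that sparse(1) IH by blast
    show ?case
      using IH collatz_collatz_branch[of x ?h, OF even] odd_collatz_branch_iff[of x ?h, OF even]
      by (simp add: itinerary_Suc funpow_swap1)
  qed simp
  then show "(\<not> 2 dvd foldr collatz_branch xs g) = hd (xs @ [\<not> 2 dvd g])"
    and "(collatz ^^ length xs) (foldr collatz_branch xs g) = g"
    and "itinerary (length xs) (foldr collatz_branch xs g) = xs"
    by auto
qed

text \<open>The slope is the product of the slopes of the branches, \<open>zadic2_third\<close> for
  \<open>True\<close> and 2 for \<open>False\<close>, so a single \<open>False\<close> makes it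
  even. Differences keep the constant term out of the induction.\<close>

lemma foldr_collatz_branch_affine:
  "\<exists>A. (\<forall>g h. foldr collatz_branch xs g - foldr collatz_branch xs h = A * (g - h)) \<and>
    (False \<in> set xs \<longrightarrow> 2 dvd A)"
proof (induction xs)
  case Nil
  show ?case
    by (auto intro: exI[of _ 1])
next
  case (Cons x xs)
  then obtain A where A: "\<And>g h. foldr collatz_branch xs g - foldr collatz_branch xs h = A * (g - h)"
      "False \<in> set xs \<Longrightarrow> 2 dvd A"
    by blast
  let ?c = "if x then zadic2_third else 2"
  have "collatz_branch x u - collatz_branch x v = ?c * (u - v)" for u v
    by (simp add: collatz_branch_def algebra_simps)
  then have "foldr collatz_branch (x # xs) g - foldr collatz_branch (x # xs) h = ?c * A * (g - h)" for g h
    by (simp add: A(1) mult.assoc)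
  moreover have "2 dvd ?c * A" if "False \<in> set (x # xs)"
    using that A(2) by auto
  ultimately show ?case
    by blast
qed

text \<open>The equation \<open>?F 0 + A * f = f\<close> is linear in \<open>f\<close>, and
  \<open>1 - A\<close> is a unit with inverse \<open>u\<close>; the only solution is therefore
  \<open>u * ?F 0\<close>.\<close>

lemma ex1_fixed_foldr_collatz_branch:
  assumes "False \<in> set xs"
  shows "\<exists>!f. foldr collatz_branch xs f = f"
proof -
  let ?F = "foldr collatz_branch xs"
  obtain A where A: "\<And>g h. ?F g - ?F h = A * (g - h)" "2 dvd A"
    using foldr_collatz_branch_affine[of xs] assms by blast
  obtain u where u: "(1 - A) * u = 1"
    using zadic2_even_unit[OF A(2)] by blast
  have affine: "?F f = ?F 0 + A * f" for f
    using A(1)[of f 0] by (simp add: algebra_simps)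
  have "?F f = f \<longleftrightarrow> f = u * ?F 0" for f
  proof
    assume "?F f = f"
    then have "(1 - A) * f = ?F 0"
      using affine[of f] by (simp add: algebra_simps)
    then have "u * ?F 0 = (1 - A) * u * f"
      by (simp only: mult_ac flip: \<open>(1 - A) * f = ?F 0\<close>)
    then show "f = u * ?F 0"
      using u by simp
  next
    assume f: "f = u * ?F 0"
    have "?F 0 = (1 - A) * f"
      unfolding f by (simp only: mult.assoc[symmetric] u mult_1)
    then show "?F f = f"
      using affine[of f] by (simp add: algebra_simps)
  qed
  then show ?thesis
    by simp
qed

section \<open>Counting itineraries\<close>

text \<open>The final letter \<open>b\<close> is the parity after \<open>n\<close> steps and does not belong to the word, so that
  \<open>paths n b b\<close> consists of the cyclic words of length \<open>n\<close> with first letter \<open>b\<close>.\<close>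

definition paths :: "nat \<Rightarrow> bool \<Rightarrow> bool \<Rightarrow> bool list set" where
  "paths n a b = {xs. length xs = n \<and> sparse (xs @ [b]) \<and> hd (xs @ [b]) = a}"

lemma finite_paths [simp]: "finite (paths n a b)"
  by (rule finite_subset[OF _ finite_lists_length_eq[of UNIV n]]) (auto simp: paths_def)

lemma paths_0: "paths 0 a b = (if a = b then {[]} else {})"
  by (auto simp: paths_def)

lemma paths_Suc:
  "paths (Suc n) a b = (#) a ` (if a then paths n False b else paths n False b \<union> paths n True b)"
  by (auto simp: paths_def length_Suc_conv successively_Cons image_iff)

lemma card_paths_Suc:
  "card (paths (Suc n) a b) = card (paths n False b) + (if a then 0 else card (paths n True b))"
proof -
  have "paths n False b \<inter> paths n True b = {}"
    by (auto simp: paths_def)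
  then show ?thesis
    by (simp add: paths_Suc card_image card_Un_disjoint)
qed

text \<open>\<open>card_paths_Suc\<close> multiplies by the matrix with rows (1, 1) and (1, 0), and
  the count is the trace of its \<open>n\<close>-th power. It has the Fibonacci recurrence with
  initial values 2 and 1, as has the sum of the powers of the two roots.\<close>

lemma card_closed_paths:
  fixes \<phi> \<psi> :: real
  assumes "\<phi> = (1 + sqrt 5) / 2" and "\<psi> = (1 - sqrt 5) / 2"
  shows "real (card (paths n False False) + card (paths n True True)) = \<phi> ^ n + \<psi> ^ n"
proof -
  let ?L = "\<lambda>n. real (card (paths n False False) + card (paths n True True))"
  have sq: "\<phi> * \<phi> = \<phi> + 1" "\<psi> * \<psi> = \<psi> + 1"
    unfolding assms by (simp_all add: field_simps)
  have rec: "?L (Suc (Suc n)) = ?L (Suc n) + ?L n" for n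
    by (simp add: card_paths_Suc)
  have "?L n = \<phi> ^ n + \<psi> ^ n \<and> ?L (Suc n) = \<phi> ^ Suc n + \<psi> ^ Suc n"
  proof (induction n)
    case 0
    show ?case
      using assms by (simp add: card_paths_Suc paths_0 field_simps)
  next
    case (Suc n)
    have "\<phi> ^ Suc (Suc n) = \<phi> ^ Suc n + \<phi> ^ n" "\<psi> ^ Suc (Suc n) = \<psi> ^ Suc n + \<psi> ^ n"
      using sq by (simp_all add: mult.assoc[symmetric] distrib_right)
    then show ?case
      using Suc rec[of n] by simp
  qed
  then show ?thesis ..
qed

text \<open>In a word with two or more letters one of the first two is \<open>False\<close>. The
  word \<open>[True]\<close> is excluded since its end letter would be \<open>True\<close> as
  well.\<close>

lemma closed_path_contains_False:
  assumes "xs \<in> paths n b b" and "n \<ge> 1"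
  shows "False \<in> set xs"
proof (cases xs)
  case (Cons x ys)
  show ?thesis
  proof (cases ys)
    case Nil
    then show ?thesis
      using assms Cons by (auto simp: paths_def)
  next
    case (Cons y zs)
    then show ?thesis
      using assms \<open>xs = x # ys\<close> by (auto simp: paths_def)
  qed
qed (use assms in \<open>simp add: paths_def\<close>)

text \<open>A fixed point of the iterate is also the unique fixed point of the branches composed
  along its itinerary, which gives injectivity. Conversely, the fixed point belonging to a closed
  path has that path as its itinerary.\<close>

lemma bij_betw_itinerary:
  assumes "n \<ge> 1"
  shows "bij_betw (itinerary n) {f. (collatz ^^ n) f = f} (\<Union>b. paths n b b)"
  unfolding bij_betw_def
proof
  have closed: "itinerary n f \<in> paths n (\<not> 2 dvd f) (\<not> 2 dvd f)" if "(collatz ^^ n) f = f" for f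
    using sparse_itinerary[of n f] that by (simp add: paths_def)
  have fixed: "foldr collatz_branch (itinerary n f) f = f" if "(collatz ^^ n) f = f" for f
    using foldr_collatz_branch_itinerary[of n f] that by simp
  show "inj_on (itinerary n) {f. (collatz ^^ n) f = f}"
  proof (rule inj_onI)
    fix f g
    assume "f \<in> {f. (collatz ^^ n) f = f}" "g \<in> {f. (collatz ^^ n) f = f}"
      and eq: "itinerary n f = itinerary n g"
    then have f: "(collatz ^^ n) f = f" and g: "(collatz ^^ n) g = g"
      by auto
    have "\<exists>!h. foldr collatz_branch (itinerary n f) h = h"
      using closed_path_contains_False[OF closed[OF f] assms] by (rule ex1_fixed_foldr_collatz_branch)
    then show "f = g"
      using fixed[OF f] fixed[OF g] eq by metis
  qed
  show "itinerary n ` {f. (collatz ^^ n) f = f} = (\<Union>b. paths n b b)"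
  proof
    show "itinerary n ` {f. (collatz ^^ n) f = f} \<subseteq> (\<Union>b. paths n b b)"
      using closed by blast
    show "(\<Union>b. paths n b b) \<subseteq> itinerary n ` {f. (collatz ^^ n) f = f}"
    proof
      fix xs assume "xs \<in> (\<Union>b. paths n b b)"
      then obtain b where xs: "xs \<in> paths n b b"
        by blast
      then have False_mem: "False \<in> set xs"
        using assms by (rule closed_path_contains_False)
      then obtain f where f: "foldr collatz_branch xs f = f"
        using ex1_fixed_foldr_collatz_branch by blast
      \<comment> \<open>The end letter of the path is \<open>b\<close>, whereas
        \<open>itinerary_foldr_collatz_branch\<close> asks for the parity of \<open>f\<close>. They
        agree because \<open>f\<close> is a value of the first branch, whose letter is
        \<open>b\<close>.\<close>
      have "(\<not> 2 dvd f) = b"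
      proof (cases xs)
        case (Cons x ys)
        have x: "x = b"
          using xs Cons by (simp add: paths_def)
        have eq: "f = collatz_branch x (foldr collatz_branch ys f)"
          using f Cons by simp
        have "2 dvd foldr collatz_branch ys f" if odd: x
        proof -
          \<comment> \<open>As \<open>xs\<close> starts with \<open>True\<close> but contains
            \<open>False\<close>, a second letter exists; it is \<open>False\<close>, and the even
            branch has even values.\<close>
          obtain zs where "ys = False # zs"
            using xs Cons odd x False_mem by (cases ys) (auto simp: paths_def)
          then show ?thesis
            by (simp add: collatz_branch_def)
        qed
        from odd_collatz_branch_iff[of x, OF this] show ?thesis
          using x eq by simp
      qed (use False_mem in simp)
      then have "sparse (xs @ [\<not> 2 dvd f])" and "length xs = n"
        using xs by (simp_all add: paths_def)
      then have "(collatz ^^ n) f = f" and "itinerary n f = xs"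
        using itinerary_foldr_collatz_branch[of xs f] f by auto
      then show "xs \<in> itinerary n ` {f. (collatz ^^ n) f = f}"
        by blast
    qed
  qed
qed

lemma finite_collatz_funpow_fixed:
  assumes "n \<ge> 1"
  shows "finite {f. (collatz ^^ n) f = f}"
  using bij_betw_finite[OF bij_betw_itinerary[OF assms]] by simp

lemma card_collatz_funpow_fixed:
  assumes "n \<ge> 1"
  shows "card {f. (collatz ^^ n) f = f} = card (paths n False False) + card (paths n True True)"
proof -
  have "card {f. (collatz ^^ n) f = f} = card (\<Union>b. paths n b b)"
    using bij_betw_itinerary[OF assms] by (rule bij_betw_same_card)
  also have "(\<Union>b. paths n b b) = paths n False False \<union> paths n True True"
    by (auto simp: UNIV_bool)
  also have "card \<dots> = card (paths n False False) + card (paths n True True)"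
  proof (rule card_Un_disjoint)
    \<comment> \<open>The first letter separates the two sets; for \<open>n = 0\<close> both would
      contain the empty word.\<close>
    show "paths n False False \<inter> paths n True True = {}"
    proof (rule equals0I)
      fix xs assume "xs \<in> paths n False False \<inter> paths n True True"
      then show False
        using assms by (cases xs) (auto simp: paths_def)
    qed
  qed simp_all
  finally show ?thesis .
qed

section \<open>The cycle count and its asymptotics\<close>

text \<open>Moebius inversion is applied to \<open>d * card (cycles collatz d)\<close>, whose sum
  over the divisors of \<open>m\<close> counts the fixed points of the \<open>m\<close>-th
  iterate.\<close>

lemma card_cycles_collatz:
  fixes \<phi> \<psi> :: real
  assumes "\<phi> = (1 + sqrt 5) / 2" and "\<psi> = (1 - sqrt 5) / 2" and "n \<ge> 1"
  shows "real n * real (card (cycles collatz n)) =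
    (\<Sum>d | d dvd n. real_of_int (moebius_mu d) * (\<phi> ^ (n div d) + \<psi> ^ (n div d)))"
proof (rule moebius_inversion)
  fix m :: nat assume m: "m \<ge> 1"
  have "\<phi> ^ m + \<psi> ^ m = real (card {f. (collatz ^^ m) f = f})"
    using card_closed_paths[OF assms(1,2)] card_collatz_funpow_fixed[OF m] by simp
  also have "\<dots> = (\<Sum>d | d dvd m. real d * real (card (cycles collatz d)))"
    using card_funpow_fixed_eq_sum_cycles[OF m finite_collatz_funpow_fixed[OF m]] by simp
  finally show "\<phi> ^ m + \<psi> ^ m = (\<Sum>d | d dvd m. real d * real (card (cycles collatz d)))" .
qed (fact assms(3))

lemma abs_moebius_mu_le: "\<bar>moebius_mu d\<bar> \<le> 1"
  by (simp add: moebius_mu_def power_abs)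

text \<open>Only \<open>d = 1\<close> contributes to first order: for \<open>d \<ge> 2\<close> the exponent \<open>n div d\<close> is at most
  \<open>n / 2\<close>, and there are at most \<open>n\<close> divisors.\<close>

lemma moebius_sum_power_estimate:
  fixes x y :: real
  assumes "x > 1" and "\<bar>y\<bar> \<le> 1" and n: "n \<ge> 1"
  shows "\<bar>(\<Sum>d | d dvd n. real_of_int (moebius_mu d) * (x ^ (n div d) + y ^ (n div d))) - x ^ n\<bar>
    \<le> 1 + 2 * real n * sqrt x ^ n"
proof -
  let ?t = "\<lambda>d. real_of_int (moebius_mu d) * (x ^ (n div d) + y ^ (n div d))"
  let ?D = "{d. d dvd n} - {1}"
  have fin: "finite {d. d dvd n}"
    using n by simp
  have "(\<Sum>d | d dvd n. ?t d) = ?t 1 + (\<Sum>d\<in>?D. ?t d)"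
    using fin by (rule sum.remove) simp
  also have "?t 1 = x ^ n + y ^ n"
    by (simp add: moebius_mu_def)
  finally have "\<bar>(\<Sum>d | d dvd n. ?t d) - x ^ n\<bar> \<le> \<bar>y ^ n\<bar> + \<bar>\<Sum>d\<in>?D. ?t d\<bar>"
    by linarith
  also have "\<bar>y ^ n\<bar> \<le> 1"
    using assms(2) by (simp add: power_abs power_le_one)
  also have "\<bar>\<Sum>d\<in>?D. ?t d\<bar> \<le> real n * (2 * sqrt x ^ n)"
  proof -
    have bound: "\<bar>?t d\<bar> \<le> 2 * sqrt x ^ n" if "d \<in> ?D" for d
    proof -
      let ?m = "n div d"
      have "d \<ge> 2"
        using that n by (cases d) auto
      then have "2 * ?m \<le> d * ?m"
        by (rule mult_le_mono1)
      also have "d * ?m = n"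
        using that by simp
      finally have m: "2 * ?m \<le> n" .
      \<comment> \<open>Powers of \<open>sqrt x\<close> avoid the possibly fractional exponent
        \<open>n / 2\<close>.\<close>
      have "x ^ ?m = sqrt x ^ (2 * ?m)"
        using assms(1) by (simp add: power_mult)
      also have "\<dots> \<le> sqrt x ^ n"
        using m assms(1) by (intro power_increasing) auto
      finally have x: "x ^ ?m \<le> sqrt x ^ n" .
      have "\<bar>y ^ ?m\<bar> \<le> 1"
        using assms(2) by (simp add: power_abs power_le_one)
      also have "1 \<le> sqrt x ^ n"
        using assms(1) by (intro one_le_power) auto
      finally have y: "\<bar>y ^ ?m\<bar> \<le> sqrt x ^ n" .
      have "\<bar>?t d\<bar> \<le> 1 * \<bar>x ^ ?m + y ^ ?m\<bar>"
        unfolding abs_mult using abs_moebius_mu_le[of d] by (intro mult_right_mono) auto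
      moreover have "x ^ ?m \<ge> 0"
        using assms(1) by simp
      then have "\<bar>x ^ ?m + y ^ ?m\<bar> \<le> 2 * sqrt x ^ n"
        using x y by linarith
      ultimately show ?thesis
        by simp
    qed
    have "\<bar>\<Sum>d\<in>?D. ?t d\<bar> \<le> (\<Sum>d\<in>?D. \<bar>?t d\<bar>)"
      by (rule sum_abs)
    also have "\<dots> \<le> real (card ?D) * (2 * sqrt x ^ n)"
      using bound by (rule sum_bounded_above)
    also have "\<dots> \<le> real n * (2 * sqrt x ^ n)"
    proof (rule mult_right_mono)
      have "?D \<subseteq> {1..n}"
        using n by (auto simp: Suc_le_eq dvd_pos_nat dvd_imp_le)
      then show "real (card ?D) \<le> real n"
        using card_mono[of "{1..n}" ?D] by simp
    qed (use assms(1) in simp)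
    finally show ?thesis .
  qed
  finally show ?thesis
    by (simp add: mult_ac)
qed

theorem theorem1p4:
  fixes \<phi> \<psi> :: real
  assumes "\<phi> = (1 + sqrt 5) / 2" and "\<psi> = (1 - sqrt 5) / 2"
  shows "(\<forall>n\<ge>1. finite (cycles collatz n) \<and>
           real (card (cycles collatz n)) =
             1 / real n * (\<Sum>d | d dvd n. real_of_int (moebius_mu d) * (\<phi> ^ (n div d) + \<psi> ^ (n div d))))
         \<and> (\<lambda>n. real (card (cycles collatz n))) \<sim>[at_top] (\<lambda>n. \<phi> ^ n / real n)"
proof (intro conjI allI impI)
  fix n :: nat assume n: "n \<ge> 1"
  show "finite (cycles collatz n)"
    using n finite_collatz_funpow_fixed[OF n] by (rule finite_cycles)
  show "real (card (cycles collatz n)) =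
      1 / real n * (\<Sum>d | d dvd n. real_of_int (moebius_mu d) * (\<phi> ^ (n div d) + \<psi> ^ (n div d)))"
    using n by (simp flip: card_cycles_collatz[OF assms n])
next
  have "1 < sqrt 5" "sqrt 5 < 3"
    by (auto intro: real_less_lsqrt)
  then have \<phi>: "\<phi> > 1" and \<psi>: "\<bar>\<psi>\<bar> \<le> 1"
    unfolding assms by auto
  let ?Z = "\<lambda>n. real (card (cycles collatz n))"
  \<comment> \<open>This is \<open>sqrt \<phi> / \<phi>\<close>, the growth rate of the error term
    relative to the main term. It is below 1, so even \<open>n * ?q ^ n\<close> tends to 0.\<close>
  let ?q = "1 / sqrt \<phi>"
  have bound: "\<bar>?Z n / (\<phi> ^ n / real n) - 1\<bar> \<le> (1 / \<phi>) ^ n + 2 * (real n * ?q ^ n)" if n: "n \<ge> 1" for n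
  proof -
    have "?Z n / (\<phi> ^ n / real n) - 1 = (real n * ?Z n - \<phi> ^ n) / \<phi> ^ n"
      using \<phi> by (simp add: field_simps)
    then have "\<bar>?Z n / (\<phi> ^ n / real n) - 1\<bar> = \<bar>real n * ?Z n - \<phi> ^ n\<bar> / \<phi> ^ n"
      using \<phi> by simp
    also have "\<dots> \<le> (1 + 2 * real n * sqrt \<phi> ^ n) / \<phi> ^ n"
      using moebius_sum_power_estimate[OF \<phi> \<psi> n] card_cycles_collatz[OF assms n] \<phi>
      by (intro divide_right_mono) auto
    also have "\<dots> = (1 / \<phi>) ^ n + 2 * (real n * (sqrt \<phi> / \<phi>) ^ n)"
      by (simp add: add_divide_distrib power_divide)
    also have "sqrt \<phi> / \<phi> = ?q"
      using \<phi> by (simp add: field_simps)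
    finally show ?thesis .
  qed
  have "(\<lambda>n. (1 / \<phi>) ^ n + 2 * (real n * ?q ^ n)) \<longlonglongrightarrow> 0 + 2 * 0"
    using \<phi> by (intro tendsto_intros LIMSEQ_power_zero powser_times_n_limit_0) simp_all
  then have lim: "(\<lambda>n. (1 / \<phi>) ^ n + 2 * (real n * ?q ^ n)) \<longlonglongrightarrow> 0"
    by (simp only: mult_zero_right add_0)
  have "(\<lambda>n. ?Z n / (\<phi> ^ n / real n) - 1) \<longlonglongrightarrow> 0"
  proof (rule tendsto_0_le[where K = 1, OF lim eventually_sequentiallyI])
    fix n :: nat assume "n \<ge> 1"
    from order_trans[OF bound[OF this] abs_ge_self]
    show "norm (?Z n / (\<phi> ^ n / real n) - 1) \<le> norm ((1 / \<phi>) ^ n + 2 * (real n * ?q ^ n)) * 1"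
      by (simp only: real_norm_def mult_1_right)
  qed
  then have "(\<lambda>n. ?Z n / (\<phi> ^ n / real n)) \<longlonglongrightarrow> 1"
    by (simp add: LIM_zero_iff)
  then show "?Z \<sim>[at_top] (\<lambda>n. \<phi> ^ n / real n)"
    by (rule asymp_equivI')
qed

end
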